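(* Let $m$ be a non-negative integer and let $G$ be a geometric graph with $n=|V(G)|\ge 1$ vertices such that for every edge $uv\in E(G)$, the number $|DJ(uv)|$ of edges of $G$ disjoint from $uv$ is at most $m$. Then \[ |E(G)|\le \max\left(|V(G)|\,\frac{\sqrt{1+8m}+3}{4},\ |V(G)|+3m-1\right). \]
   Context: A geometric graph is a graph drawn in the plane whose vertex set is a finite set of points in general position (no three collinear) and whose edges are straight line segments joining pairs of these points. Two edges are disjoint if the corresponding closed segments have no common point (in particular they share no endpoint). For an edge $uv$, $DJ(uv)$ denotes the set of edges of $G$ disjoint from $uv$. *)

theory Defs
  imports "HOL-Analysis.Analysis"
begin

definition general_position :: "(real^2) set \<Rightarrow> bool" where
  "general_position V \<longleftrightarrow> (\<forall>T. T \<subseteq> V \<and> card T = 3 \<longrightarrow> \<not> collinear T)"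

text \<open>
  An edge is the set of its two endpoints; it is drawn as the closed segment joining them,
  so the drawing is determined by the vertex set and the edge set.
\<close>
definition geometric_graph :: "(real^2) set \<Rightarrow> (real^2) set set \<Rightarrow> bool" where
  "geometric_graph V E \<longleftrightarrow>
     finite V \<and> general_position V \<and>
     (\<forall>e\<in>E. \<exists>u v. u \<in> V \<and> v \<in> V \<and> u \<noteq> v \<and> e = {u, v})"

definition DJ :: "(real^2) set set \<Rightarrow> real^2 \<Rightarrow> real^2 \<Rightarrow> (real^2) set set" where
  "DJ E u v = {f \<in> E. \<exists>x y. f = {x, y} \<and> closed_segment u v \<inter> closed_segment x y = {}}"

end

(*
  If the edges at some vertex u are not contained in an open half-plane, three of them, ua, ub, uc,
  surround u. A line missing u misses one of the three rays, so every edge not at u is disjoint from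
  one of ua, ub, uc, and |E| <= (n - 1) + 3m.

  Otherwise the edges at every vertex are linearly ordered from left to right; let r(x, v) be the
  number of edges at x to the left of xv. If vw is the leftmost edge at v, then for every other edge
  vx, the edges at x to the left of xv lie on the other side of the line vx from w, hence are
  disjoint from vw. So the ranks r(x, v), with x ranging over the neighbours of v other than w, add
  up to at most m. Altogether at least 2|E| - n ranks add up to at most nm, while each value is
  attained at most n times, as the ranks at a vertex are distinct. Comparing with the smallest
  possible sum of that many ranks gives (d - 1)(d - 2)/2 <= m for the average degree d.
*)
theory Submission
  imports Defs
begin

section \<open>Orientation of triples of points\<close>

text \<open>Twice the signed area of the triangle: positive when \<open>c\<close> lies to the left
  of the directed line from \<open>a\<close> to \<open>b\<close>.\<close>

definition orient :: "real^2 \<Rightarrow> real^2 \<Rightarrow> real^2 \<Rightarrow> real" where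
  "orient a b c = (b$1 - a$1) * (c$2 - a$2) - (b$2 - a$2) * (c$1 - a$1)"

lemma orient_swap: "orient a c b = - orient a b c"
  by (simp add: orient_def algebra_simps)

lemma orient_rotate: "orient b c a = orient a b c"
  by (simp add: orient_def algebra_simps)

lemma orient_refl [simp]: "orient a b b = 0" "orient a a b = 0" "orient a b a = 0"
  by (simp_all add: orient_def)

lemma orient_affine:
  "orient a b ((1 - t) *\<^sub>R p + t *\<^sub>R q) = (1 - t) * orient a b p + t * orient a b q"
  by (simp add: orient_def algebra_simps)

lemma orient_eq_0_imp_collinear:
  assumes "orient a b c = 0"
  shows "collinear {a, b, c}"
proof (cases "b = a")
  case False
  then have ne: "b$1 - a$1 \<noteq> 0 \<or> b$2 - a$2 \<noteq> 0"
    by (auto simp: vec_eq_iff forall_2)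
  have "\<exists>k. c - a = k *\<^sub>R (b - a)"
  proof (cases "b$1 - a$1 = 0")
    case True
    with ne have "b$2 - a$2 \<noteq> 0" by simp
    with True assms have "c - a = ((c$2 - a$2) / (b$2 - a$2)) *\<^sub>R (b - a)"
      by (simp add: vec_eq_iff forall_2 orient_def)
    then show ?thesis by blast
  next
    case False
    moreover have "c$2 - a$2 = (c$1 - a$1) * (b$2 - a$2) / (b$1 - a$1)"
      using False assms by (simp add: orient_def eq_divide_eq mult.commute)
    ultimately have "c - a = ((c$1 - a$1) / (b$1 - a$1)) *\<^sub>R (b - a)"
      by (simp add: vec_eq_iff forall_2)
    then show ?thesis by blast
  qed
  then have "collinear {0, b - a, c - a}"
    unfolding collinear_lemma by blast
  then have "collinear {b, a, c}"
    by (subst collinear_3) simp_all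
  then show ?thesis
    by (simp add: insert_commute)
qed auto

text \<open>A common point would lie on the line through \<open>v\<close> and \<open>x\<close>. By
  the strict signs, the first segment meets that line only in \<open>v\<close> and the second only
  in \<open>x\<close>, and \<open>v\<close> differs from \<open>x\<close>.\<close>

lemma disjoint_segments_if_separated:
  assumes "orient v x w > 0" "orient v x y < 0"
  shows "closed_segment v w \<inter> closed_segment x y = {}"
proof (rule ccontr)
  assume "closed_segment v w \<inter> closed_segment x y \<noteq> {}"
  then obtain p s t where
    s: "0 \<le> s" "s \<le> 1" "p = (1 - s) *\<^sub>R v + s *\<^sub>R w" and
    t: "0 \<le> t" "t \<le> 1" "p = (1 - t) *\<^sub>R x + t *\<^sub>R y"
    unfolding closed_segment_def by blast
  have "orient v x p = s * orient v x w"
    unfolding s(3) orient_affine by simp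
  moreover have "orient v x p = t * orient v x y"
    unfolding t(3) orient_affine by simp
  moreover have "s * orient v x w \<ge> 0" "t * orient v x y \<le> 0"
    using assms s(1) t(1) by (simp_all add: mult_nonneg_nonpos)
  ultimately have "s * orient v x w = 0" "t * orient v x y = 0"
    by linarith+
  then have "s = 0" "t = 0"
    using assms by auto
  then have "v = x"
    using s(3) t(3) by simp
  then show False
    using assms by simp
qed

text \<open>The affine function \<open>orient x y\<close> vanishes on the segment
  \<open>x y\<close>. Along a segment from \<open>u\<close> that meets it, this function must
  therefore move from its value at \<open>u\<close> towards zero. It cannot do so in all three
  directions, because \<open>u\<close> is inside the triangle \<open>a b c\<close>.\<close>

lemma surrounding_segments:
  assumes "orient u a b > 0" "orient u b c > 0" "orient u c a > 0"
    and "orient x y u \<noteq> 0"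
    and "closed_segment u a \<inter> closed_segment x y \<noteq> {}"
      "closed_segment u b \<inter> closed_segment x y \<noteq> {}"
  shows "closed_segment u c \<inter> closed_segment x y = {}"
proof (rule ccontr)
  assume c: "closed_segment u c \<inter> closed_segment x y \<noteq> {}"
  define h where "h = orient x y"
  have opposite: "h u * (h z - h u) < 0" if "closed_segment u z \<inter> closed_segment x y \<noteq> {}" for z
  proof -
    from that obtain p s t where
      s: "0 \<le> s" "s \<le> 1" "p = (1 - s) *\<^sub>R u + s *\<^sub>R z" and
      t: "p = (1 - t) *\<^sub>R x + t *\<^sub>R y"
      unfolding closed_segment_def by blast
    have "h p = 0"
      unfolding h_def t orient_affine by simp
    then have eq: "s * (h z - h u) = - h u"
      unfolding h_def s orient_affine by (simp add: algebra_simps)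
    then have "s * (h u * (h z - h u)) = - (h u * h u)"
      by (metis mult.left_commute mult_minus_right)
    also have "\<dots> < 0"
      using assms(4) by (auto simp: h_def zero_less_mult_iff)
    finally show ?thesis
      using s(1) by (simp add: mult_less_0_iff)
  qed
  \<comment> \<open>Barycentric coordinates: weighted with these three positive areas,
    \<open>a\<close>, \<open>b\<close>, \<open>c\<close> average to \<open>u\<close>, and
    \<open>h\<close> is affine.\<close>
  have "orient u b c * (h a - h u) + orient u c a * (h b - h u) + orient u a b * (h c - h u) = 0"
    by (simp add: h_def orient_def algebra_simps)
  then have "orient u b c * (h u * (h a - h u)) + orient u c a * (h u * (h b - h u))
      + orient u a b * (h u * (h c - h u)) = 0"
    by algebra
  moreover have "orient u b c * (h u * (h a - h u)) < 0" "orient u c a * (h u * (h b - h u)) < 0"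
    "orient u a b * (h u * (h c - h u)) < 0"
    using assms(1-3) opposite [OF assms(5)] opposite [OF assms(6)] opposite [OF c]
    by (simp_all add: mult_pos_neg)
  ultimately show False
    by linarith
qed

section \<open>Counting in linear orders and for distinct values\<close>

lemma inj_on_card_successors:
  assumes "finite A"
    and irrefl: "\<And>x. x \<in> A \<Longrightarrow> \<not> R x x"
    and total: "\<And>x y. \<lbrakk>x \<in> A; y \<in> A; x \<noteq> y\<rbrakk> \<Longrightarrow> R x y \<or> R y x"
    and trans: "\<And>x y z. \<lbrakk>x \<in> A; y \<in> A; z \<in> A; R x y; R y z\<rbrakk> \<Longrightarrow> R x z"
  shows "inj_on (\<lambda>x. card {y \<in> A. R x y}) A"
proof -
  have less: "card {z \<in> A. R y z} < card {z \<in> A. R x z}" if "x \<in> A" "y \<in> A" "R x y" for x y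
  proof (rule psubset_card_mono)
    show "{z \<in> A. R y z} \<subset> {z \<in> A. R x z}"
      using that irrefl trans by blast
  qed (use assms(1) in simp)
  show ?thesis
  proof (rule inj_onI, rule ccontr)
    fix x y
    assume "x \<in> A" "y \<in> A" "card {z \<in> A. R x z} = card {z \<in> A. R y z}" "x \<noteq> y"
    then show False
      using total [of x y] less [of x y] less [of y x] by auto
  qed
qed

text \<open>The truncated difference is the shortfall of \<open>f x\<close> below \<open>K\<close>.
  For distinct values the total shortfall is largest when all of 0, ..., \<open>K\<close> occur.
  Bounding shortfalls for every \<open>K\<close> takes the place of sorting the ranks and comparing
  with their smallest possible sum.\<close>

lemma sum_truncated_diff_le:
  assumes "finite A" "inj_on f A"
  shows "2 * (\<Sum>x\<in>A. K - f x) \<le> K * (K + 1 :: nat)"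
proof -
  have "(\<Sum>x\<in>A. K - f x) = (\<Sum>i\<in>f ` A. K - i)"
    by (simp add: sum.reindex [OF assms(2)])
  also have "\<dots> = (\<Sum>i\<in>f ` A \<inter> {..K}. K - i)"
    by (rule sum.mono_neutral_right) (use assms in auto)
  also have "\<dots> \<le> (\<Sum>i\<le>K. K - i)"
    by (rule sum_mono2) auto
  also have "\<dots> = (\<Sum>i\<le>K. i)"
    by (rule sum.reindex_bij_witness [of _ "\<lambda>i. K - i" "\<lambda>i. K - i"]) auto
  finally have "2 * (\<Sum>x\<in>A. K - f x) \<le> 2 * (\<Sum>i\<le>K. i)"
    by simp
  also have "\<dots> = K * (K + 1)"
    by (induction K) auto
  finally show ?thesis .
qed

section \<open>Neighbours and degrees in a geometric graph\<close>

definition neighbours :: "'a set set \<Rightarrow> 'a \<Rightarrow> 'a set" where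
  "neighbours E v = {w. {v, w} \<in> E}"

definition edge_rank :: "(real^2) set set \<Rightarrow> real^2 \<Rightarrow> real^2 \<Rightarrow> nat" where
  "edge_rank E x v = card {y \<in> neighbours E x. orient x v y > 0}"

lemma neighbours_commute: "w \<in> neighbours E v \<longleftrightarrow> v \<in> neighbours E w"
  by (simp add: neighbours_def insert_commute)

lemma DJ_subset: "DJ E u v \<subseteq> E"
  by (auto simp: DJ_def)

context
  fixes V :: "(real^2) set" and E :: "(real^2) set set"
  assumes G: "geometric_graph V E"
begin

lemma finite_vertices: "finite V"
  using G by (simp add: geometric_graph_def)

lemma edgeE:
  assumes "e \<in> E"
  obtains u v where "u \<in> V" "v \<in> V" "u \<noteq> v" "e = {u, v}"
  using assms G unfolding geometric_graph_def by blast

lemma finite_edges: "finite E"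
proof (rule finite_subset)
  show "E \<subseteq> Pow V"
    by (auto elim!: edgeE)
qed (simp add: finite_vertices)

lemma neighbours_subset: "neighbours E v \<subseteq> V - {v}"
  by (auto simp: neighbours_def doubleton_eq_iff elim!: edgeE)

lemma vertex_of_edge: "w \<in> neighbours E v \<Longrightarrow> v \<in> V"
  using neighbours_subset [of w] neighbours_commute [of w E v] by blast

lemma finite_neighbours: "finite (neighbours E v)"
  using neighbours_subset finite_vertices by (meson finite_Diff finite_subset)

lemma orient_nonzero:
  assumes "a \<in> V" "b \<in> V" "c \<in> V" "a \<noteq> b" "b \<noteq> c" "a \<noteq> c"
  shows "orient a b c \<noteq> 0"
proof
  assume "orient a b c = 0"
  then have "collinear {a, b, c}"
    by (rule orient_eq_0_imp_collinear)
  moreover have "card {a, b, c} = 3" "{a, b, c} \<subseteq> V"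
    using assms by auto
  ultimately show False
    using G unfolding geometric_graph_def general_position_def by blast
qed

lemma orient_neighbours:
  assumes "a \<in> neighbours E u" "b \<in> neighbours E u" "a \<noteq> b"
  shows "orient u a b > 0 \<or> orient u b a > 0"
proof -
  have "orient u a b \<noteq> 0"
    using assms neighbours_subset vertex_of_edge by (intro orient_nonzero) blast+
  then show ?thesis
    unfolding orient_swap [of u b a] by linarith
qed

lemma card_incident_edges: "card {e \<in> E. v \<in> e} = card (neighbours E v)"
proof -
  have "bij_betw (\<lambda>w. {v, w}) (neighbours E v) {e \<in> E. v \<in> e}"
    unfolding bij_betw_def
  proof
    show "(\<lambda>w. {v, w}) ` neighbours E v = {e \<in> E. v \<in> e}"
    proof safe
      fix e assume e: "e \<in> E" "v \<in> e"
      then obtain w where "e = {v, w}"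
        by (elim edgeE) blast
      with e(1) show "e \<in> (\<lambda>w. {v, w}) ` neighbours E v"
        by (simp add: neighbours_def)
    qed (simp_all add: neighbours_def)
  qed (auto simp: inj_on_def doubleton_eq_iff)
  then show ?thesis
    by (simp add: bij_betw_same_card)
qed

lemma sum_degrees: "(\<Sum>v\<in>V. card (neighbours E v)) = 2 * card E"
proof -
  have "(\<Sum>v\<in>V. card {e \<in> E. v \<in> e}) = 2 * card E"
  proof (rule sum_multicount, safe)
    fix e assume "e \<in> E"
    then obtain u v where "u \<in> V" "v \<in> V" "u \<noteq> v" "e = {u, v}"
      by (rule edgeE)
    then have "{i \<in> V. i \<in> e} = {u, v}"
      by auto
    with \<open>u \<noteq> v\<close> show "card {i \<in> V. i \<in> e} = 2"
      by simp
  qed (auto simp: finite_vertices finite_edges)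
  then show ?thesis
    by (simp add: card_incident_edges)
qed

section \<open>A vertex surrounded by three of its edges\<close>

lemma card_edges_le_if_surrounded:
  assumes "a \<in> neighbours E u" "b \<in> neighbours E u" "c \<in> neighbours E u"
    and orient: "orient u a b > 0" "orient u b c > 0" "orient u c a > 0"
    and m: "\<And>u v. {u, v} \<in> E \<Longrightarrow> card (DJ E u v) \<le> m"
  shows "card E + 1 \<le> card V + 3 * m"
proof -
  have "E \<subseteq> {e \<in> E. u \<in> e} \<union> (DJ E u a \<union> (DJ E u b \<union> DJ E u c))"
  proof
    fix e assume e: "e \<in> E"
    then obtain x y where xy: "x \<in> V" "y \<in> V" "x \<noteq> y" "e = {x, y}"
      by (rule edgeE)
    show "e \<in> {e \<in> E. u \<in> e} \<union> (DJ E u a \<union> (DJ E u b \<union> DJ E u c))"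
    proof (cases "u \<in> e")
      case False
      \<comment> \<open>By general position, a vertex not on the edge is also off the line that the
        edge spans.\<close>
      then have "orient x y u \<noteq> 0"
        using xy vertex_of_edge [OF assms(1)] by (intro orient_nonzero) auto
      from surrounding_segments [OF orient this] show ?thesis
        using e xy(4) unfolding DJ_def by blast
    qed (use e in simp)
  qed
  then have "card E \<le> card ({e \<in> E. u \<in> e} \<union> (DJ E u a \<union> (DJ E u b \<union> DJ E u c)))"
    using finite_subset [OF DJ_subset finite_edges] finite_edges by (intro card_mono) simp_all
  also have "\<dots> \<le> card {e \<in> E. u \<in> e} + (card (DJ E u a) + (card (DJ E u b) + card (DJ E u c)))"
    by (intro order_trans [OF card_Un_le] add_left_mono card_Un_le)
  finally have "card E \<le> card (neighbours E u) + 3 * m"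
    using m [of u a] m [of u b] m [of u c] assms(1-3)
    by (simp add: card_incident_edges neighbours_def)
  \<comment> \<open>The vertex \<open>u\<close> is not its own neighbour, which saves 1.\<close>
  moreover have "card (neighbours E u) + 1 \<le> card V"
    using psubset_card_mono [OF finite_vertices, of "neighbours E u"] neighbours_subset [of u]
      vertex_of_edge [OF assms(1)] by (simp add: Suc_le_eq) blast
  ultimately show ?thesis
    by simp
qed

section \<open>Graphs whose edges are linearly ordered at every vertex\<close>

lemma sum_ranks_le:
  assumes w: "w \<in> neighbours E v"
    and leftmost: "\<And>x. x \<in> neighbours E v \<Longrightarrow> \<not> orient v w x > 0"
  shows "(\<Sum>x\<in>neighbours E v - {w}. edge_rank E x v) \<le> card (DJ E v w)"
proof -
  define S where "S = Sigma (neighbours E v - {w}) (\<lambda>x. {y \<in> neighbours E x. orient x v y > 0})"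
  \<comment> \<open>What is left of the line when looking from \<open>x\<close> to \<open>v\<close>
    is right of it when looking from \<open>v\<close> to \<open>x\<close>. As \<open>w\<close> is
    leftmost, it is on the other side.\<close>
  have less: "orient v x y < 0" if "(x, y) \<in> S" for x y
    using that orient_swap [of v x y] orient_rotate [of v y x] orient_rotate [of y x v]
    by (simp add: S_def)
  have greater: "orient v x w > 0" if "(x, y) \<in> S" for x y
    using that leftmost [of x] orient_neighbours [OF w, of x] by (auto simp: S_def)
  have "(\<Sum>x\<in>neighbours E v - {w}. edge_rank E x v) = card S"
    unfolding S_def edge_rank_def by (rule card_SigmaI [symmetric]) (simp_all add: finite_neighbours)
  also have "\<dots> \<le> card (DJ E v w)"
  proof (rule card_inj_on_le)
    \<comment> \<open>An edge could be counted twice only as \<open>(x, y)\<close> and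
      \<open>(y, x)\<close>; then \<open>orient v x y\<close> and \<open>orient v y x\<close> would
      both be negative.\<close>
    show "inj_on (\<lambda>(x, y). {x, y}) S"
    proof (rule inj_onI, clarsimp simp: doubleton_eq_iff)
      fix x y assume "(x, y) \<in> S" "(y, x) \<in> S"
      then show "x = y \<and> y = x"
        using less [of x y] less [of y x] orient_swap [of v x y] by simp
    qed
    show "(\<lambda>(x, y). {x, y}) ` S \<subseteq> DJ E v w"
    proof clarify
      fix x y assume xy: "(x, y) \<in> S"
      have "closed_segment v w \<inter> closed_segment x y = {}"
        using greater [OF xy] less [OF xy] by (rule disjoint_segments_if_separated)
      moreover have "{x, y} \<in> E"
        using xy by (simp add: S_def neighbours_def)
      ultimately show "{x, y} \<in> DJ E v w"
        unfolding DJ_def by blast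
    qed
    show "finite (DJ E v w)"
      using DJ_subset finite_edges by (rule finite_subset)
  qed
  finally show ?thesis .
qed

text \<open>Each rank \<open>r\<close> satisfies \<open>K \<le> (K - r) + r\<close>; summing over
  all neighbours but the leftmost one, the ranks contribute at most \<open>m\<close>. Assumption
  \<open>trans\<close> makes the edges at a vertex linearly ordered, so that a leftmost one
  exists.\<close>

lemma degree_le_if_pointed:
  assumes trans: "\<And>u a b c. \<lbrakk>a \<in> neighbours E u; b \<in> neighbours E u; c \<in> neighbours E u;
      orient u a b > 0; orient u b c > 0\<rbrakk> \<Longrightarrow> orient u a c > 0"
    and m: "\<And>u v. {u, v} \<in> E \<Longrightarrow> card (DJ E u v) \<le> m"
  shows "K * (card (neighbours E v) - 1) \<le> (\<Sum>x\<in>neighbours E v. K - edge_rank E x v) + m"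
proof (cases "neighbours E v = {}")
  case False
  \<comment> \<open>The pairs are reversed, so that an \<open>R\<close>-minimal neighbour is a
    leftmost one.\<close>
  define R where "R = {(y, x). x \<in> neighbours E v \<and> y \<in> neighbours E v \<and> orient v x y > 0}"
  have "R \<subseteq> neighbours E v \<times> neighbours E v"
    by (auto simp: R_def)
  then have "finite R"
    using finite_neighbours finite_subset by blast
  moreover have "trans R"
    using trans unfolding R_def trans_def by blast
  moreover have "irrefl R"
    by (simp add: R_def irrefl_def)
  ultimately have "wf R"
    by (simp add: finite_acyclic_wf acyclic_irrefl)
  then obtain w where w: "w \<in> neighbours E v" and min: "\<And>y. (y, w) \<in> R \<Longrightarrow> y \<notin> neighbours E v"
    using False by (meson ex_in_conv wfE_min)
  have "(\<Sum>x\<in>neighbours E v - {w}. edge_rank E x v) \<le> card (DJ E v w)"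
    using min w by (intro sum_ranks_le) (auto simp: R_def)
  also have "\<dots> \<le> m"
    using w by (intro m) (simp add: neighbours_def)
  finally have ranks: "(\<Sum>x\<in>neighbours E v - {w}. edge_rank E x v) \<le> m" .
  have "K * (card (neighbours E v) - 1) = (\<Sum>x\<in>neighbours E v - {w}. K)"
    using w finite_neighbours by simp
  also have "\<dots> \<le> (\<Sum>x\<in>neighbours E v - {w}. (K - edge_rank E x v) + edge_rank E x v)"
    by (rule sum_mono) simp
  also have "\<dots> \<le> (\<Sum>x\<in>neighbours E v - {w}. K - edge_rank E x v) + m"
    using ranks by (simp add: sum.distrib)
  \<comment> \<open>The term for \<open>w\<close> is put back so that the double sum over all
    vertices becomes symmetric and can be swapped.\<close>
  also have "(\<Sum>x\<in>neighbours E v - {w}. K - edge_rank E x v) \<le> (\<Sum>x\<in>neighbours E v. K - edge_rank E x v)"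
    by (rule sum_mono2) (auto simp: finite_neighbours)
  finally show ?thesis
    by simp
qed simp

lemma card_edges_le_if_pointed:
  assumes trans: "\<And>u a b c. \<lbrakk>a \<in> neighbours E u; b \<in> neighbours E u; c \<in> neighbours E u;
      orient u a b > 0; orient u b c > 0\<rbrakk> \<Longrightarrow> orient u a c > 0"
    and m: "\<And>u v. {u, v} \<in> E \<Longrightarrow> card (DJ E u v) \<le> m"
  shows "4 * (K * card E) \<le> card V * (K * (K + 1) + 2 * K + 2 * m)"
proof -
  have inj: "inj_on (edge_rank E x) (neighbours E x)" for x
    unfolding edge_rank_def
  proof (rule inj_on_card_successors)
    show "orient x v z > 0"
      if "v \<in> neighbours E x" "y \<in> neighbours E x" "z \<in> neighbours E x"
        "orient x v y > 0" "orient x y z > 0" for v y z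
      using that by (rule trans)
  qed (use finite_neighbours orient_neighbours in auto)
  \<comment> \<open>Only an inequality, because \<open>d - 1\<close> is truncated at an isolated
    vertex.\<close>
  have deg: "K * d \<le> K * (d - 1) + K" for d
    by (cases d) simp_all
  have "K * (2 * card E) = (\<Sum>v\<in>V. K * card (neighbours E v))"
    by (simp only: sum_degrees [symmetric] sum_distrib_left)
  also have "\<dots> \<le> (\<Sum>v\<in>V. K * (card (neighbours E v) - 1) + K)"
    by (rule sum_mono) (rule deg)
  also have "\<dots> \<le> (\<Sum>v\<in>V. (\<Sum>x\<in>neighbours E v. K - edge_rank E x v) + m + K)"
    by (intro sum_mono add_right_mono degree_le_if_pointed [OF trans m])
  also have "\<dots> = (\<Sum>v\<in>V. \<Sum>x\<in>neighbours E v. K - edge_rank E x v) + card V * (m + K)"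
    by (simp add: sum.distrib algebra_simps)
  also have "(\<Sum>v\<in>V. \<Sum>x\<in>neighbours E v. K - edge_rank E x v)
      = (\<Sum>v\<in>V. \<Sum>x\<in>{x \<in> V. x \<in> neighbours E v}. K - edge_rank E x v)"
    using neighbours_subset by (intro sum.cong refl) blast
  \<comment> \<open>Regroup by the vertex \<open>x\<close> at which the rank is taken, since ranks
    are distinct only among edges at the same \<open>x\<close>.\<close>
  also have "\<dots> = (\<Sum>x\<in>V. \<Sum>v\<in>{v \<in> V. x \<in> neighbours E v}. K - edge_rank E x v)"
    by (rule sum.swap_restrict) (rule finite_vertices)+
  also have "\<dots> = (\<Sum>x\<in>V. \<Sum>v\<in>neighbours E x. K - edge_rank E x v)"
  proof (rule sum.cong [OF refl])
    fix x
    have "{v \<in> V. x \<in> neighbours E v} = neighbours E x"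
      using vertex_of_edge unfolding neighbours_def by (auto simp: insert_commute)
    then show "(\<Sum>v\<in>{v \<in> V. x \<in> neighbours E v}. K - edge_rank E x v)
        = (\<Sum>v\<in>neighbours E x. K - edge_rank E x v)"
      by simp
  qed
  finally have "2 * (K * (2 * card E)) \<le>
      (\<Sum>x\<in>V. 2 * (\<Sum>v\<in>neighbours E x. K - edge_rank E x v)) + 2 * (card V * (m + K))"
    by (simp add: sum_distrib_left [symmetric])
  also have "(\<Sum>x\<in>V. 2 * (\<Sum>v\<in>neighbours E x. K - edge_rank E x v)) \<le> (\<Sum>x\<in>V. K * (K + 1))"
    by (intro sum_mono sum_truncated_diff_le finite_neighbours inj)
  finally show ?thesis
    by (simp add: algebra_simps)
qed

end

section \<open>From the family of linear bounds to the theorem\<close>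

text \<open>
  The hypothesis says that the piecewise linear interpolation of \<open>x (x - 1) / 2\<close> at the integers is
  at most \<open>m\<close> at \<open>x = 2 t - 1\<close>; by convexity, so is \<open>x (x - 1) / 2\<close> itself.
\<close>
lemma le_sqrt_if_tangents_le:
  fixes t :: real and m :: nat
  assumes "\<And>K :: nat. 4 * (real K * t) \<le> real K * (real K + 1) + 2 * real K + 2 * real m"
  shows "t \<le> (sqrt (1 + 8 * real m) + 3) / 4"
proof (cases "t \<ge> 1 / 2")
  case True
  \<comment> \<open>If \<open>t\<close> is the number of edges per vertex, then \<open>x\<close> is
    the average degree minus 1. It is nonnegative here, so its floor is a natural number.\<close>
  define x where "x = 2 * t - 1"
  define K where "K = nat \<lfloor>x\<rfloor>"
  have "real K \<le> x" "x \<le> real K + 1"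
    using True unfolding K_def x_def by linarith+
  \<comment> \<open>This is the convexity: between \<open>K\<close> and \<open>K + 1\<close>, the
    parabola lies below its chord.\<close>
  then have "(x - real K) * (x - real K - 1) \<le> 0"
    by (intro mult_nonneg_nonpos) auto
  moreover have "2 * (real K * x) \<le> real K * (real K + 1) + 2 * real m"
    using assms [of K] by (simp add: x_def algebra_simps)
  ultimately have "(2 * x - 1)\<^sup>2 \<le> 1 + 8 * real m"
    by (simp add: power2_eq_square algebra_simps)
  then have "2 * x - 1 \<le> sqrt (1 + 8 * real m)"
    by (rule real_le_rsqrt)
  then show ?thesis
    by (simp add: x_def)
next
  case False
  then have "t \<le> 3 / 4"
    by simp
  also have "\<dots> \<le> (sqrt (1 + 8 * real m) + 3) / 4"
    by simp
  finally show ?thesis .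
qed

theorem theorem1p1:
  fixes V :: "(real^2) set" and E :: "(real^2) set set" and m :: nat
  assumes "geometric_graph V E"
    and "card V \<ge> 1"
    and "\<And>u v. {u, v} \<in> E \<Longrightarrow> card (DJ E u v) \<le> m"
  shows "real (card E) \<le>
    max (real (card V) * ((sqrt (1 + 8 * real m) + 3) / 4))
        (real (card V) + 3 * real m - 1)"
proof (cases "\<forall>u a b c. a \<in> neighbours E u \<longrightarrow> b \<in> neighbours E u \<longrightarrow> c \<in> neighbours E u \<longrightarrow>
    orient u a b > 0 \<longrightarrow> orient u b c > 0 \<longrightarrow> orient u a c > 0")
  case True
  have n: "real (card V) > 0"
    using assms(2) by simp
  have "real (card E) / real (card V) \<le> (sqrt (1 + 8 * real m) + 3) / 4"
  proof (rule le_sqrt_if_tangents_le)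
    fix K :: nat
    have "4 * (K * card E) \<le> card V * (K * (K + 1) + 2 * K + 2 * m)"
      using assms(3) by (intro card_edges_le_if_pointed [OF assms(1)]) (use True in blast)+
    then have "real (4 * (K * card E)) \<le> real (card V * (K * (K + 1) + 2 * K + 2 * m))"
      by (simp only: of_nat_le_iff)
    then show "4 * (real K * (real (card E) / real (card V)))
        \<le> real K * (real K + 1) + 2 * real K + 2 * real m"
      using n by (simp add: field_simps)
  qed
  then show ?thesis
    using n by (simp add: pos_divide_le_eq mult.commute le_max_iff_disj)
next
  case False
  then obtain u a b c where abc: "a \<in> neighbours E u" "b \<in> neighbours E u" "c \<in> neighbours E u"
    and orient: "orient u a b > 0" "orient u b c > 0" "\<not> orient u a c > 0"
    by blast
  \<comment> \<open>Once \<open>a\<close> and \<open>c\<close> are distinct, general position turns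
    the failure of transitivity into the third positive orientation, so \<open>u\<close> is
    surrounded.\<close>
  have "a \<noteq> c"
    using orient orient_swap [of u a b] by auto
  then have "orient u c a > 0"
    using orient(3) orient_neighbours [OF assms(1) abc(1,3)] by blast
  with abc orient have "card E + 1 \<le> card V + 3 * m"
    using assms(3) by (intro card_edges_le_if_surrounded [OF assms(1)])
  then show ?thesis
    by (simp add: le_max_iff_disj)
qed

end
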